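(* Let $\mathbb{S}=\langle K_\alpha; r_\alpha^\beta;\kappa\rangle$ be a continuous inverse sequence of compact spaces such that (1) $K_0$ is semi-Eberlein, (2) for each $\alpha$ with $\alpha+1<\kappa$, the map $r^{\alpha+1}_\alpha\colon K_{\alpha+1}\to K_\alpha$ is a semi-open retraction with a metrizable kernel. Then $\varprojlim\mathbb{S}$ is semi-Eberlein.
   Context: All spaces are completely regular (Hausdorff) and maps are continuous. For a set $S$, $c_0(S)$ is the set of all $x\in\mathbb{R}^S$ such that for every $\varepsilon>0$ the set $\{s\in S : |x(s)|>\varepsilon\}$ is finite; $\mathbb{R}^S$ carries the product topology. A compact space $K$ is semi-Eberlein if for some set $S$ there is a topological embedding of $K$ into $\mathbb{R}^S$ such that, identifying $K$ with its image, $c_0(S)\cap K$ is dense in $K$. An inverse sequence $\langle K_\alpha; r_\alpha^\beta;\kappa\rangle$ is an inverse system indexed by the ordinals $\alpha<\kappa$ (where $\kappa>0$ is an ordinal), with bonding maps $r_\alpha^\beta\colon K_\beta\to K_\alpha$ for $\alpha\le\beta<\kappa$. It is continuous if for every limit ordinal $\delta<\kappa$ the space $K_\delta$, together with the maps $r_\alpha^\delta$ ($\alpha<\delta$), is the inverse limit of $\langle K_\alpha; r_\alpha^\beta;\delta\rangle$. A map $f\colon X\to Y$ is a retraction if, up to identifying $Y$ with a subspace of $X$, $f\restriction Y=\mathrm{id}_Y$ (equivalently, there is a continuous $i\colon Y\to X$ with $f\circ i=\mathrm{id}_Y$). A map $f\colon X\to Y$ is semi-open if for every nonempty open $U\subseteq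 X$ the image $f[U]$ has nonempty interior in $Y$. A map $f\colon X\to Y$ has a metrizable kernel if there exists a map $g\colon X\to[0,1]^\omega$ such that the diagonal product $f\,\Delta\, g\colon X\to Y\times[0,1]^\omega$, $x\mapsto\langle f(x),g(x)\rangle$, is one-to-one. *)

theory Defs
  imports "HOL-Analysis.Analysis"
begin

section \<open>Semi-Eberlein compact spaces\<close>

text \<open>
  \<open>powertop_real S\<close> has as points the functions that are \<open>undefined\<close> outside \<open>S\<close>; this is the
  space of real families indexed by \<open>S\<close>.
\<close>

definition c0 :: "'s set \<Rightarrow> ('s \<Rightarrow> real) set" where
  "c0 S = {x \<in> topspace (powertop_real S). \<forall>\<epsilon>>0. finite {s \<in> S. \<bar>x s\<bar> > \<epsilon>}}"

definition semi_Eberlein_embedding ::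
    "'a topology \<Rightarrow> 's set \<Rightarrow> ('a \<Rightarrow> 's \<Rightarrow> real) \<Rightarrow> bool" where
  "semi_Eberlein_embedding X S h \<longleftrightarrow>
     embedding_map X (powertop_real S) h \<and>
     subtopology (powertop_real S) (h ` topspace X) closure_of (c0 S \<inter> h ` topspace X)
       = h ` topspace X"

text \<open>
  The definition asks for a set \<open>S\<close> of arbitrary elements. Existential quantification over
  types is not available, so \<open>S\<close> is taken from the type \<open>'a \<Rightarrow> real\<close>; the lemma
  \<open>semi_EberleinI\<close> below shows that index sets of any other type give nothing more.
\<close>

definition semi_Eberlein :: "'a topology \<Rightarrow> bool" where
  "semi_Eberlein X \<longleftrightarrow>
     compact_space X \<and> Hausdorff_space X \<and>
     (\<exists>(S :: ('a \<Rightarrow> real) set) h. semi_Eberlein_embedding X S h)"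

lemma semi_Eberlein_embedding_dense:
  assumes "embedding_map X (powertop_real S) h"
  shows "semi_Eberlein_embedding X S h \<longleftrightarrow>
           X closure_of {x \<in> topspace X. h x \<in> c0 S} = topspace X"
proof -
  let ?D = "{x \<in> topspace X. h x \<in> c0 S}"
  let ?Y = "subtopology (powertop_real S) (h ` topspace X)"
  have hm: "homeomorphic_map X ?Y h"
    using assms by (simp add: embedding_map_def)
  have im: "c0 S \<inter> h ` topspace X = h ` ?D"
    by auto
  have cl: "?Y closure_of (h ` ?D) = h ` (X closure_of ?D)"
    using hm by (rule homeomorphic_map_closure_of) auto
  have inj: "inj_on h (topspace X)"
    using hm by (simp add: homeomorphic_eq_everything_map)
  have sub: "X closure_of ?D \<subseteq> topspace X"
    by (rule closure_of_subset_topspace)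
  show ?thesis
    unfolding semi_Eberlein_embedding_def im cl
    using assms inj_on_image_eq_iff[OF inj sub subset_refl] by simp
qed

lemma semi_EberleinI:
  fixes S :: "'s set" and X :: "'a topology"
  assumes X: "compact_space X" "Hausdorff_space X"
    and h: "semi_Eberlein_embedding X S h"
  shows "semi_Eberlein X"
proof -
  define q where "q s = restrict (\<lambda>x. h x s) (topspace X)" for s
  define F where "F = q ` S"
  define h' where "h' x = restrict (\<lambda>f. f x) F" for x
  have emb: "embedding_map X (powertop_real S) h"
    using h by (simp add: semi_Eberlein_embedding_def)
  then have hm: "homeomorphic_map X (subtopology (powertop_real S) (h ` topspace X)) h"
    by (simp add: embedding_map_def)
  have inj: "inj_on h (topspace X)"
    using hm by (simp add: homeomorphic_eq_everything_map)
  have cont: "continuous_map X (powertop_real S) h"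
    using homeomorphic_imp_continuous_map[OF hm] by (simp add: continuous_map_in_subtopology)
  have hS: "h x \<in> extensional S" if "x \<in> topspace X" for x
    using cont that by (auto simp: continuous_map_componentwise)
  have "continuous_map X euclideanreal (q s)" if "s \<in> S" for s
  proof (rule continuous_map_eq)
    show "continuous_map X euclideanreal (\<lambda>x. h x s)"
      using cont that by (simp add: continuous_map_componentwise)
  qed (simp add: q_def)
  then have cont': "continuous_map X (powertop_real F) h'"
    by (auto simp: continuous_map_componentwise h'_def F_def)
  have inj': "inj_on h' (topspace X)"
  proof (rule inj_onI)
    fix x y assume xy: "x \<in> topspace X" "y \<in> topspace X" "h' x = h' y"
    have "h x s = h y s" if "s \<in> S" for s
      using fun_cong[OF xy(3), of "q s"] that xy(1,2) by (simp add: h'_def F_def q_def)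
    then have "h x = h y"
      using extensionalityI[OF hS hS] xy(1,2) by blast
    then show "x = y"
      using inj xy(1,2) by (simp add: inj_on_eq_iff)
  qed
  have "Hausdorff_space (powertop_real F)"
    by (simp add: Hausdorff_space_product_topology)
  then have emb': "embedding_map X (powertop_real F) h'"
    using X(1) cont' inj'
    by (intro injective_closed_imp_embedding_map continuous_imp_closed_map)
  have "h' x \<in> c0 F" if x: "x \<in> topspace X" "h x \<in> c0 S" for x
  proof -
    have "finite {f \<in> F. \<bar>h' x f\<bar> > \<epsilon>}" if "\<epsilon> > 0" for \<epsilon>
    proof (rule finite_subset)
      show "{f \<in> F. \<bar>h' x f\<bar> > \<epsilon>} \<subseteq> q ` {s \<in> S. \<bar>h x s\<bar> > \<epsilon>}"
        using x(1) by (auto simp: h'_def F_def q_def)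
      show "finite (q ` {s \<in> S. \<bar>h x s\<bar> > \<epsilon>})"
        using x(2) that by (auto simp: c0_def)
    qed
    then show ?thesis
      by (auto simp: c0_def h'_def)
  qed
  then have "{x \<in> topspace X. h x \<in> c0 S} \<subseteq> {x \<in> topspace X. h' x \<in> c0 F}"
    by auto
  then have "X closure_of {x \<in> topspace X. h x \<in> c0 S}
      \<subseteq> X closure_of {x \<in> topspace X. h' x \<in> c0 F}"
    by (rule closure_of_mono)
  moreover have "X closure_of {x \<in> topspace X. h x \<in> c0 S} = topspace X"
    using h semi_Eberlein_embedding_dense[OF emb] by simp
  ultimately have "X closure_of {x \<in> topspace X. h' x \<in> c0 F} = topspace X"
    using closure_of_subset_topspace[of X] by blast
  then have "semi_Eberlein_embedding X F h'"
    by (simp add: semi_Eberlein_embedding_dense[OF emb'])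
  then show ?thesis
    using X by (auto simp: semi_Eberlein_def)
qed

section \<open>Maps\<close>

definition semi_open_map :: "'a topology \<Rightarrow> 'b topology \<Rightarrow> ('a \<Rightarrow> 'b) \<Rightarrow> bool" where
  "semi_open_map X Y f \<longleftrightarrow>
     (\<forall>U. openin X U \<and> U \<noteq> {} \<longrightarrow> Y interior_of (f ` U) \<noteq> {})"

definition has_metrizable_kernel :: "'a topology \<Rightarrow> ('a \<Rightarrow> 'b) \<Rightarrow> bool" where
  "has_metrizable_kernel X f \<longleftrightarrow>
     (\<exists>g :: 'a \<Rightarrow> nat \<Rightarrow> real.
        continuous_map X (product_topology (\<lambda>_. top_of_set {0..1}) UNIV) g \<and>
        inj_on (\<lambda>x. (f x, g x)) (topspace X))"

section \<open>Inverse sequences\<close>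

text \<open>
  An ordinal is represented by a well-order relation \<open>r\<close>, its elements being those of
  \<open>Field r\<close>; an element \<open>\<delta>\<close>, viewed as an ordinal itself, is \<open>Restr r (underS r \<delta>)\<close>.
  The bonding map from \<open>K \<beta>\<close> to \<open>K \<alpha>\<close> is \<open>p \<alpha> \<beta>\<close>.
\<close>

definition ord_zero :: "'i rel \<Rightarrow> 'i" where
  "ord_zero r = wo_rel.minim r (Field r)"

text \<open>Meaningful only if \<open>\<alpha>\<close> is not the largest element, that is, if \<open>aboveS r \<alpha> \<noteq> {}\<close>.\<close>

definition ord_succ :: "'i rel \<Rightarrow> 'i \<Rightarrow> 'i" where
  "ord_succ r \<alpha> = wo_rel.suc r {\<alpha>}"

text \<open>Zero is not counted as a limit.\<close>

definition ord_limit :: "'i rel \<Rightarrow> 'i \<Rightarrow> bool" where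
  "ord_limit r \<delta> \<longleftrightarrow>
     \<delta> \<in> Field r \<and> \<delta> \<noteq> ord_zero r \<and>
     \<not> (\<exists>\<alpha>\<in>Field r. aboveS r \<alpha> \<noteq> {} \<and> \<delta> = ord_succ r \<alpha>)"

definition inverse_sequence ::
    "'i rel \<Rightarrow> ('i \<Rightarrow> 'a topology) \<Rightarrow> ('i \<Rightarrow> 'i \<Rightarrow> 'a \<Rightarrow> 'a) \<Rightarrow> bool" where
  "inverse_sequence r K p \<longleftrightarrow>
     Well_order r \<and> Field r \<noteq> {} \<and>
     (\<forall>\<alpha> \<beta>. (\<alpha>, \<beta>) \<in> r \<longrightarrow> continuous_map (K \<beta>) (K \<alpha>) (p \<alpha> \<beta>)) \<and>
     (\<forall>\<alpha>\<in>Field r. \<forall>x\<in>topspace (K \<alpha>). p \<alpha> \<alpha> x = x) \<and>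
     (\<forall>\<alpha> \<beta> \<gamma>. (\<alpha>, \<beta>) \<in> r \<and> (\<beta>, \<gamma>) \<in> r \<longrightarrow>
        (\<forall>x\<in>topspace (K \<gamma>). p \<alpha> \<beta> (p \<beta> \<gamma> x) = p \<alpha> \<gamma> x))"

definition inverse_limit ::
    "'i rel \<Rightarrow> ('i \<Rightarrow> 'a topology) \<Rightarrow> ('i \<Rightarrow> 'i \<Rightarrow> 'a \<Rightarrow> 'a) \<Rightarrow> ('i \<Rightarrow> 'a) topology" where
  "inverse_limit r K p =
     subtopology (product_topology K (Field r)) {x. \<forall>(\<alpha>, \<beta>)\<in>r. p \<alpha> \<beta> (x \<beta>) = x \<alpha>}"

text \<open>
  That \<open>K \<delta>\<close> with the maps \<open>p \<alpha> \<delta>\<close> is the inverse limit means that the canonical map to the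
  space of threads is a homeomorphism.
\<close>

definition continuous_inverse_sequence ::
    "'i rel \<Rightarrow> ('i \<Rightarrow> 'a topology) \<Rightarrow> ('i \<Rightarrow> 'i \<Rightarrow> 'a \<Rightarrow> 'a) \<Rightarrow> bool" where
  "continuous_inverse_sequence r K p \<longleftrightarrow>
     inverse_sequence r K p \<and>
     (\<forall>\<delta>. ord_limit r \<delta> \<longrightarrow>
        homeomorphic_map (K \<delta>) (inverse_limit (Restr r (underS r \<delta>)) K p)
          (\<lambda>x. \<lambda>\<alpha>\<in>underS r \<delta>. p \<alpha> \<delta> x))"

end

theory Submission
  imports Defs
begin

text \<open>
  Fix sections \<open>s \<alpha>\<close> of the successor maps. A point \<open>y\<close> of \<open>K \<alpha>\<close> extends to a thread that at each
  later successor step follows the section; at limit steps continuity of the sequence supplies the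
  point, and uniqueness of such extensions makes the choices coherent. The limit embeds into a real
  power by the coordinates of \<open>K 0\<close> together with, for each successor step, countably many
  coordinates coming from the metrizable kernel, normalised to vanish on the image of the section
  and to tend to \<open>0\<close>. By transfinite induction on \<open>\<alpha>\<close>, every nonempty open subset of \<open>K \<alpha>\<close> is hit
  by a \<open>c0\<close> thread following the sections from \<open>\<alpha>\<close> on: at a successor, semi-openness allows one to
  modify a single step, which adds only one null sequence of coordinates; at a limit, an open set
  already depends on an earlier \<open>\<alpha>\<close>.
\<close>

section \<open>Inverse limits\<close>

text \<open>The threads form an intersection of equalizers of continuous maps into Hausdorff spaces,
  hence a closed subset of the product, which is compact by Tychonoff.\<close>

lemma inverse_limit_compact_Hausdorff:
  assumes "inverse_sequence r K p"
    and "\<And>\<alpha>. \<alpha> \<in> Field r \<Longrightarrow> compact_space (K \<alpha>) \<and> Hausdorff_space (K \<alpha>)"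
  shows "compact_space (inverse_limit r K p) \<and> Hausdorff_space (inverse_limit r K p)"
proof -
  let ?P = "product_topology K (Field r)"
  let ?E = "\<lambda>(\<alpha>, \<beta>). {x \<in> topspace ?P. p \<alpha> \<beta> (x \<beta>) = x \<alpha>}"
  \<comment> \<open>An intersection over an empty index set would be \<open>UNIV\<close> rather than
    \<open>topspace ?P\<close>.\<close>
  have ne: "r \<noteq> {}"
    using assms(1) by (auto simp: inverse_sequence_def)
  have "closedin ?P (?E e)" if "e \<in> r" for e
  proof -
    obtain \<alpha> \<beta> where e: "e = (\<alpha>, \<beta>)"
      by fastforce
    have F: "\<alpha> \<in> Field r" "\<beta> \<in> Field r"
      using that e by (auto simp: Field_def)
    have "continuous_map ?P (K \<alpha>) (p \<alpha> \<beta> \<circ> (\<lambda>x. x \<beta>))"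
      using assms(1) that e F
      by (intro continuous_map_compose[OF continuous_map_product_projection])
         (auto simp: inverse_sequence_def)
    moreover have "continuous_map ?P (K \<alpha>) (\<lambda>x. x \<alpha>)"
      using F(1) by (rule continuous_map_product_projection)
    ultimately have "closedin ?P {x \<in> topspace ?P. (p \<alpha> \<beta> \<circ> (\<lambda>x. x \<beta>)) x = x \<alpha>}"
      using assms(2) F by (intro closedin_continuous_maps_eq[of "K \<alpha>"]) blast+
    then show ?thesis
      by (simp add: e o_def)
  qed
  then have "closedin ?P (\<Inter>e\<in>r. ?E e)"
    using ne by (intro closedin_Inter) auto
  moreover have "inverse_limit r K p = subtopology ?P (\<Inter>e\<in>r. ?E e)"
  proof -
    have "topspace ?P \<inter> {x. \<forall>(\<alpha>, \<beta>)\<in>r. p \<alpha> \<beta> (x \<beta>) = x \<alpha>} = (\<Inter>e\<in>r. ?E e)"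
      using ne by auto
    then show ?thesis
      unfolding inverse_limit_def by (metis subtopology_restrict)
  qed
  moreover have "compact_space ?P" "Hausdorff_space ?P"
    using assms(2) by (auto simp: compact_space_product_topology Hausdorff_space_product_topology)
  ultimately show ?thesis
    by (auto intro: Hausdorff_space_subtopology closedin_compact_space compact_space_subtopology)
qed

section \<open>Threads of a sequence with sections\<close>

locale retractive_sequence = wo_rel r for r :: "'i rel" +
  fixes K :: "'i \<Rightarrow> 'a topology" and p :: "'i \<Rightarrow> 'i \<Rightarrow> 'a \<Rightarrow> 'a" and s :: "'i \<Rightarrow> 'a \<Rightarrow> 'a"
  assumes seq: "continuous_inverse_sequence r K p"
    and section_maps: "\<And>\<alpha>. \<alpha> \<in> Field r \<Longrightarrow> aboveS \<alpha> \<noteq> {} \<Longrightarrow>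
      retraction_maps (K (ord_succ r \<alpha>)) (K \<alpha>) (p \<alpha> (ord_succ r \<alpha>)) (s \<alpha>)"
begin

abbreviation le (infix "\<sqsubseteq>" 50) where "\<alpha> \<sqsubseteq> \<beta> \<equiv> (\<alpha>, \<beta>) \<in> r"
abbreviation lt (infix "\<sqsubset>" 50) where "\<alpha> \<sqsubset> \<beta> \<equiv> \<alpha> \<in> underS \<beta>"
abbreviation next_index ("\<sigma>") where "\<sigma> \<equiv> ord_succ r"
text \<open>The value of \<open>ord_succ\<close> is meaningful only where a strictly larger index
  exists; this condition accompanies the uses of \<open>\<sigma>\<close>.\<close>

abbreviation has_next where "has_next \<alpha> \<equiv> \<alpha> \<in> Field r \<and> aboveS \<alpha> \<noteq> {}"

section \<open>Order facts about the index set\<close>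

lemma le_Field: "\<alpha> \<sqsubseteq> \<beta> \<Longrightarrow> \<alpha> \<in> Field r \<and> \<beta> \<in> Field r"
  by (auto simp: Field_def)

lemma le_refl: "\<alpha> \<in> Field r \<Longrightarrow> \<alpha> \<sqsubseteq> \<alpha>"
  using REFL by (auto simp: refl_on_def)

lemma le_trans: "\<alpha> \<sqsubseteq> \<beta> \<Longrightarrow> \<beta> \<sqsubseteq> \<gamma> \<Longrightarrow> \<alpha> \<sqsubseteq> \<gamma>"
  using TRANS by (auto simp: trans_def)

lemma le_antisym: "\<alpha> \<sqsubseteq> \<beta> \<Longrightarrow> \<beta> \<sqsubseteq> \<alpha> \<Longrightarrow> \<alpha> = \<beta>"
  using ANTISYM by (auto simp: antisym_def)

lemma lt_iff: "\<alpha> \<sqsubset> \<beta> \<longleftrightarrow> \<alpha> \<sqsubseteq> \<beta> \<and> \<alpha> \<noteq> \<beta>"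
  by (auto simp: underS_def)

lemma not_le: "\<alpha> \<in> Field r \<Longrightarrow> \<beta> \<in> Field r \<Longrightarrow> \<not> \<alpha> \<sqsubseteq> \<beta> \<Longrightarrow> \<beta> \<sqsubset> \<alpha>"
  using TOTALS le_refl by (auto simp: lt_iff)

lemma AboveS_singleton: "\<alpha> \<in> Field r \<Longrightarrow> AboveS {\<alpha>} = aboveS \<alpha>"
  by (auto simp: AboveS_def aboveS_def Field_def)

lemma lt_next: "has_next \<alpha> \<Longrightarrow> \<alpha> \<sqsubset> \<sigma> \<alpha>"
  using suc_greater[of "{\<alpha>}" \<alpha>] AboveS_singleton by (auto simp: ord_succ_def lt_iff)

lemma next_le: "\<alpha> \<sqsubset> \<beta> \<Longrightarrow> \<sigma> \<alpha> \<sqsubseteq> \<beta>"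
  using suc_least_AboveS[of \<beta> "{\<alpha>}"] le_Field[of \<alpha> \<beta>]
  by (auto simp: ord_succ_def lt_iff AboveS_singleton aboveS_def)

lemma has_nextI: "\<alpha> \<sqsubset> \<beta> \<Longrightarrow> has_next \<alpha>"
  using le_Field[of \<alpha> \<beta>] by (auto simp: lt_iff aboveS_def)

lemma lt_next_iff: "has_next \<beta> \<Longrightarrow> \<alpha> \<sqsubset> \<sigma> \<beta> \<longleftrightarrow> \<alpha> \<sqsubseteq> \<beta>"
  by (metis le_Field le_antisym le_trans lt_iff lt_next next_le not_le)

lemma next_inj: "has_next \<alpha> \<Longrightarrow> has_next \<beta> \<Longrightarrow> \<sigma> \<alpha> = \<sigma> \<beta> \<Longrightarrow> \<alpha> = \<beta>"
  by (metis le_antisym lt_next lt_next_iff)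

lemma Field_nonempty: "Field r \<noteq> {}"
  using seq by (simp add: continuous_inverse_sequence_def inverse_sequence_def)

lemma zero_in: "ord_zero r \<in> Field r"
  unfolding ord_zero_def using minim_in[of "Field r"] Field_nonempty by blast

lemma zero_le: "\<alpha> \<in> Field r \<Longrightarrow> ord_zero r \<sqsubseteq> \<alpha>"
  unfolding ord_zero_def by (rule minim_least) auto

text \<open>By the definition of \<open>ord_limit\<close>, an index that is neither zero nor a limit
  is the successor of a smaller one, so well-founded induction splits into these three
  cases.\<close>

lemma ord_induct [consumes 1, case_names zero succ limit]:
  assumes "\<delta> \<in> Field r"
    and zero: "P (ord_zero r)"
    and succ: "\<And>\<beta>. has_next \<beta> \<Longrightarrow> P \<beta> \<Longrightarrow> P (\<sigma> \<beta>)"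
    and limit: "\<And>\<delta>. ord_limit r \<delta> \<Longrightarrow> (\<And>\<beta>. \<beta> \<sqsubset> \<delta> \<Longrightarrow> P \<beta>) \<Longrightarrow> P \<delta>"
  shows "P \<delta>"
proof -
  have "\<delta> \<in> Field r \<longrightarrow> P \<delta>"
  proof (induction \<delta> rule: well_order_induct)
    case (1 \<delta>)
    then have IH: "P \<beta>" if "\<beta> \<sqsubset> \<delta>" for \<beta>
      using that le_Field by (auto simp: lt_iff)
    show ?case
    proof
      assume \<delta>: "\<delta> \<in> Field r"
      show "P \<delta>"
      proof (cases "ord_limit r \<delta> \<or> \<delta> = ord_zero r")
        case True
        then show ?thesis using zero limit IH by blast
      next
        case False
        then obtain \<beta> where "has_next \<beta>" "\<delta> = \<sigma> \<beta>"
          using \<delta> by (auto simp: ord_limit_def)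
        then show ?thesis
          using succ IH lt_next by metis
      qed
    qed
  qed
  then show ?thesis using assms(1) by blast
qed

lemma next_lt_limit:
  assumes "ord_limit r \<delta>" "\<beta> \<sqsubset> \<delta>"
  shows "\<sigma> \<beta> \<sqsubset> \<delta>"
  using assms next_le[OF assms(2)] has_nextI[OF assms(2)] by (auto simp: lt_iff ord_limit_def)

lemma zero_lt_limit: "ord_limit r \<delta> \<Longrightarrow> ord_zero r \<sqsubset> \<delta>"
  using zero_le by (auto simp: lt_iff ord_limit_def)

section \<open>Bonding maps and sections\<close>

lemma p_continuous: "\<alpha> \<sqsubseteq> \<beta> \<Longrightarrow> continuous_map (K \<beta>) (K \<alpha>) (p \<alpha> \<beta>)"
  using seq by (auto simp: continuous_inverse_sequence_def inverse_sequence_def)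

lemma p_in: "\<alpha> \<sqsubseteq> \<beta> \<Longrightarrow> x \<in> topspace (K \<beta>) \<Longrightarrow> p \<alpha> \<beta> x \<in> topspace (K \<alpha>)"
  using p_continuous continuous_map_funspace by fastforce

lemma p_id: "\<alpha> \<in> Field r \<Longrightarrow> x \<in> topspace (K \<alpha>) \<Longrightarrow> p \<alpha> \<alpha> x = x"
  using seq by (auto simp: continuous_inverse_sequence_def inverse_sequence_def)

lemma p_p: "\<alpha> \<sqsubseteq> \<beta> \<Longrightarrow> \<beta> \<sqsubseteq> \<gamma> \<Longrightarrow> x \<in> topspace (K \<gamma>) \<Longrightarrow> p \<alpha> \<beta> (p \<beta> \<gamma> x) = p \<alpha> \<gamma> x"
  using seq by (auto simp: continuous_inverse_sequence_def inverse_sequence_def)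

lemma s_continuous: "has_next \<alpha> \<Longrightarrow> continuous_map (K \<alpha>) (K (\<sigma> \<alpha>)) (s \<alpha>)"
  using section_maps by (auto simp: retraction_maps_def)

lemma s_in: "has_next \<alpha> \<Longrightarrow> x \<in> topspace (K \<alpha>) \<Longrightarrow> s \<alpha> x \<in> topspace (K (\<sigma> \<alpha>))"
  using s_continuous continuous_map_funspace by fastforce

lemma p_s: "has_next \<alpha> \<Longrightarrow> x \<in> topspace (K \<alpha>) \<Longrightarrow> p \<alpha> (\<sigma> \<alpha>) (s \<alpha> x) = x"
  using section_maps by (auto simp: retraction_maps_def)

section \<open>Initial segments and threads over them\<close>

lemma ofilter_D: "ofilter A \<Longrightarrow> \<gamma> \<in> A \<Longrightarrow> \<beta> \<sqsubseteq> \<gamma> \<Longrightarrow> \<beta> \<in> A"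
  by (auto simp: ofilter_def under_def)

lemma ofilter_Field: "ofilter A \<Longrightarrow> \<gamma> \<in> A \<Longrightarrow> \<gamma> \<in> Field r"
  by (auto simp: ofilter_def)

text \<open>For an initial segment \<open>A\<close> these are the points of the inverse limit over
  \<open>A\<close>, except that values outside \<open>A\<close> are left free. One function can
  therefore serve for several segments.\<close>

definition thread :: "'i set \<Rightarrow> ('i \<Rightarrow> 'a) \<Rightarrow> bool" where
  "thread A z \<longleftrightarrow>
     (\<forall>\<gamma>\<in>A. z \<gamma> \<in> topspace (K \<gamma>) \<and> (\<forall>\<beta>. \<beta> \<sqsubseteq> \<gamma> \<longrightarrow> p \<beta> \<gamma> (z \<gamma>) = z \<beta>))"

lemma thread_in: "thread A z \<Longrightarrow> \<gamma> \<in> A \<Longrightarrow> z \<gamma> \<in> topspace (K \<gamma>)"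
  by (simp add: thread_def)

lemma thread_p: "thread A z \<Longrightarrow> \<gamma> \<in> A \<Longrightarrow> \<beta> \<sqsubseteq> \<gamma> \<Longrightarrow> p \<beta> \<gamma> (z \<gamma>) = z \<beta>"
  by (simp add: thread_def)

lemma thread_subset: "thread A z \<Longrightarrow> B \<subseteq> A \<Longrightarrow> thread B z"
  by (auto simp: thread_def)

lemma thread_of_point:
  assumes "\<delta> \<in> Field r" "x \<in> topspace (K \<delta>)"
  shows "thread (under \<delta>) (\<lambda>\<gamma>. p \<gamma> \<delta> x)"
  using assms by (auto simp: thread_def under_def p_in p_p)

lemma Field_Restr: "ofilter A \<Longrightarrow> Field (Restr r A) = A"
  using Field_Restr_ofilter WELL by blast

text \<open>Since \<open>A\<close> is closed downward, the pairs in \<open>Restr r A\<close> are all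
  the pairs of \<open>r\<close> with upper end in \<open>A\<close>, which are the ones that
  \<open>thread\<close> refers to.\<close>

lemma topspace_limit:
  assumes "ofilter A"
  shows "topspace (inverse_limit (Restr r A) K p) = {z \<in> extensional A. thread A z}"
  using ofilter_D[OF assms]
  by (fastforce simp: inverse_limit_def Field_Restr[OF assms] thread_def PiE_iff)

lemma limit_homeomorphism:
  assumes "ord_limit r \<delta>"
  shows "homeomorphic_map (K \<delta>) (inverse_limit (Restr r (underS \<delta>)) K p)
           (\<lambda>x. \<lambda>\<alpha>\<in>underS \<delta>. p \<alpha> \<delta> x)"
  using seq assms by (simp add: continuous_inverse_sequence_def)

text \<open>This is the injectivity half of continuity of the sequence at
  \<open>\<delta>\<close>.\<close>

lemma limit_eqI:
  assumes "ord_limit r \<delta>" "x \<in> topspace (K \<delta>)" "y \<in> topspace (K \<delta>)"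
    and "\<And>\<beta>. \<beta> \<sqsubset> \<delta> \<Longrightarrow> p \<beta> \<delta> x = p \<beta> \<delta> y"
  shows "x = y"
proof -
  have "inj_on (\<lambda>x. \<lambda>\<alpha>\<in>underS \<delta>. p \<alpha> \<delta> x) (topspace (K \<delta>))"
    using limit_homeomorphism[OF assms(1)] by (simp add: homeomorphic_eq_everything_map)
  moreover have "(\<lambda>\<alpha>\<in>underS \<delta>. p \<alpha> \<delta> x) = (\<lambda>\<alpha>\<in>underS \<delta>. p \<alpha> \<delta> y)"
    by (rule restrict_ext) (rule assms(4))
  ultimately show ?thesis
    using assms(2,3) by (rule inj_onD)
qed

text \<open>This is the surjectivity half of continuity at \<open>\<delta>\<close>. The thread is
  first restricted, because points of the limit space are \<open>undefined\<close> off
  \<open>underS \<delta>\<close>.\<close>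

lemma limit_point_exists:
  assumes "ord_limit r \<delta>" "thread (underS \<delta>) z"
  obtains x where "x \<in> topspace (K \<delta>)" "\<And>\<beta>. \<beta> \<sqsubset> \<delta> \<Longrightarrow> p \<beta> \<delta> x = z \<beta>"
proof -
  let ?z = "restrict z (underS \<delta>)"
  have of: "ofilter (underS \<delta>)"
    by (rule underS_ofilter)
  have "thread (underS \<delta>) ?z"
    using assms(2) ofilter_D[OF of] by (auto simp: thread_def)
  then have "?z \<in> topspace (inverse_limit (Restr r (underS \<delta>)) K p)"
    by (simp add: topspace_limit[OF of])
  then have "?z \<in> (\<lambda>x. \<lambda>\<alpha>\<in>underS \<delta>. p \<alpha> \<delta> x) ` topspace (K \<delta>)"
    using limit_homeomorphism[OF assms(1)] unfolding homeomorphic_eq_everything_map by blast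
  then obtain x where x: "?z = (\<lambda>\<alpha>\<in>underS \<delta>. p \<alpha> \<delta> x)" "x \<in> topspace (K \<delta>)"
    by (rule imageE)
  show thesis
  proof
    show "p \<beta> \<delta> x = z \<beta>" if "\<beta> \<sqsubset> \<delta>" for \<beta>
      using fun_cong[OF x(1), of \<beta>] that by simp
  qed (rule x(2))
qed

text \<open>Below \<open>\<alpha>\<close> the values are projections of the common value at
  \<open>\<alpha>\<close>; above it, successors are handled by \<open>step\<close> and limits by
  \<open>limit_eqI\<close>. The hypothesis \<open>step\<close> is left abstract because it is
  supplied once by the sections and once by the kernel coordinates.\<close>

lemma thread_determined:
  assumes "ofilter A" "thread A z" "thread A z'" "\<alpha> \<in> A" "z \<alpha> = z' \<alpha>" "\<gamma> \<in> A"
    and step: "\<And>\<beta>. has_next \<beta> \<Longrightarrow> \<alpha> \<sqsubseteq> \<beta> \<Longrightarrow> \<sigma> \<beta> \<in> A \<Longrightarrow> z \<beta> = z' \<beta> \<Longrightarrow> z (\<sigma> \<beta>) = z' (\<sigma> \<beta>)"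
  shows "z \<gamma> = z' \<gamma>"
proof -
  have low: "z \<gamma> = z' \<gamma>" if "\<gamma> \<sqsubseteq> \<alpha>" for \<gamma>
    using thread_p[OF assms(2,4) that] thread_p[OF assms(3,4) that] assms(5) by simp
  have "\<gamma> \<in> Field r"
    using assms by (blast intro: ofilter_Field)
  then show ?thesis
    using \<open>\<gamma> \<in> A\<close>
  proof (induction \<gamma> rule: ord_induct)
    case zero
    then show ?case
      using low zero_le ofilter_Field assms(1,4) by blast
  next
    case (succ \<beta>)
    have "\<beta> \<sqsubset> \<sigma> \<beta>"
      using succ.hyps by (rule lt_next)
    then have "z \<beta> = z' \<beta>"
      using succ assms(1) ofilter_D by (auto simp: lt_iff)
    \<comment> \<open>No index lies strictly between \<open>\<beta>\<close> and
      \<open>\<sigma> \<beta>\<close>, so \<open>\<alpha>\<close> is on one side of this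
      step.\<close>
    moreover have "\<sigma> \<beta> \<sqsubseteq> \<alpha> \<or> \<alpha> \<sqsubseteq> \<beta>"
      using succ lt_next_iff not_le ofilter_Field assms(1,4) by metis
    ultimately show ?case
      using low step succ by blast
  next
    case (limit \<delta>)
    show ?case
    proof (rule limit_eqI[OF limit.hyps(1)])
      show "z \<delta> \<in> topspace (K \<delta>)" "z' \<delta> \<in> topspace (K \<delta>)"
        using limit.prems assms(2,3) by (auto intro: thread_in)
      show "p \<beta> \<delta> (z \<delta>) = p \<beta> \<delta> (z' \<delta>)" if "\<beta> \<sqsubset> \<delta>" for \<beta>
      proof -
        have "\<beta> \<sqsubseteq> \<delta>"
          using that by (simp add: lt_iff)
        then show ?thesis
          using limit.IH[OF that] ofilter_D[OF assms(1) limit.prems]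
            thread_p[OF assms(2) limit.prems] thread_p[OF assms(3) limit.prems] by simp
      qed
    qed
  qed
qed

section \<open>Threads that follow the sections from a given index on\<close>

definition follows :: "'i \<Rightarrow> 'i set \<Rightarrow> ('i \<Rightarrow> 'a) \<Rightarrow> bool" where
  "follows \<alpha> A z \<longleftrightarrow> (\<forall>\<beta>. has_next \<beta> \<and> \<alpha> \<sqsubseteq> \<beta> \<and> \<sigma> \<beta> \<in> A \<longrightarrow> z (\<sigma> \<beta>) = s \<beta> (z \<beta>))"

lemma followsD: "follows \<alpha> A z \<Longrightarrow> has_next \<beta> \<Longrightarrow> \<alpha> \<sqsubseteq> \<beta> \<Longrightarrow> \<sigma> \<beta> \<in> A \<Longrightarrow> z (\<sigma> \<beta>) = s \<beta> (z \<beta>)"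
  by (auto simp: follows_def)

lemma follows_mono: "follows \<alpha> A z \<Longrightarrow> \<alpha> \<sqsubseteq> \<beta> \<Longrightarrow> B \<subseteq> A \<Longrightarrow> follows \<beta> B z"
  unfolding follows_def using le_trans by blast

text \<open>From \<open>\<alpha>\<close> on, both threads apply the same map
  \<open>s \<beta>\<close> to equal values. This is the source of coherence when extensions are
  chosen separately.\<close>

lemma follows_unique:
  assumes "ofilter A" "thread A z" "thread A z'" "\<alpha> \<in> A" "z \<alpha> = z' \<alpha>" "\<gamma> \<in> A"
    and "follows \<alpha> A z" "follows \<alpha> A z'"
  shows "z \<gamma> = z' \<gamma>"
  using assms(1-6)
proof (rule thread_determined)
  fix \<beta> assume "has_next \<beta>" "\<alpha> \<sqsubseteq> \<beta>" "\<sigma> \<beta> \<in> A" "z \<beta> = z' \<beta>"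
  then show "z (\<sigma> \<beta>) = z' (\<sigma> \<beta>)"
    using followsD[OF assms(7)] followsD[OF assms(8)] by metis
qed

text \<open>Extensions of \<open>y\<close> to the single spaces \<open>K \<delta>\<close> agree by
  uniqueness, so they assemble into one thread over \<open>A\<close>. Taking \<open>A\<close> to be
  \<open>underS \<delta>\<close> serves the limit step of the construction, and taking it to be
  \<open>Field r\<close> yields threads of the whole sequence.\<close>

lemma glue_threads:
  assumes A: "ofilter A" "\<alpha> \<in> A" and y: "y \<in> topspace (K \<alpha>)"
    and w: "\<And>\<delta>. \<delta> \<in> A \<Longrightarrow> \<alpha> \<sqsubseteq> \<delta> \<Longrightarrow>
      \<exists>x\<in>topspace (K \<delta>). p \<alpha> \<delta> x = y \<and> follows \<alpha> (under \<delta>) (\<lambda>\<gamma>. p \<gamma> \<delta> x)"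
  obtains z where "thread A z" "z \<alpha> = y" "follows \<alpha> A z"
proof -
  have \<alpha>: "\<alpha> \<in> Field r"
    using A by (rule ofilter_Field)
  \<comment> \<open>The points \<open>w \<delta>\<close> are picked independently of each other;
    \<open>coh\<close> then shows that they fit together.\<close>
  obtain w where w: "w \<delta> \<in> topspace (K \<delta>)" "p \<alpha> \<delta> (w \<delta>) = y"
      "follows \<alpha> (under \<delta>) (\<lambda>\<gamma>. p \<gamma> \<delta> (w \<delta>))" if "\<delta> \<in> A" "\<alpha> \<sqsubseteq> \<delta>" for \<delta>
    using w by metis
  have coh: "p \<gamma> \<delta> (w \<delta>) = w \<gamma>" if "\<delta> \<in> A" "\<alpha> \<sqsubseteq> \<gamma>" "\<gamma> \<sqsubseteq> \<delta>" for \<gamma> \<delta>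
  proof -
    have le: "\<alpha> \<sqsubseteq> \<delta>" and \<gamma>: "\<gamma> \<in> A" "\<gamma> \<in> Field r" "\<delta> \<in> Field r"
      using that le_trans le_Field ofilter_D[OF A(1)] by blast+
    have sub: "under \<gamma> \<subseteq> under \<delta>"
      using that(3) le_trans by (auto simp: under_def)
    \<comment> \<open>The threads induced by \<open>w \<delta>\<close> and \<open>w \<gamma>\<close>
      on \<open>under \<gamma>\<close> have the value \<open>y\<close> at \<open>\<alpha>\<close>
      and both follow the sections. The redundant \<open>p \<gamma> \<gamma>\<close> gives the right
      side the shape of such a thread.\<close>
    have "p \<gamma> \<delta> (w \<delta>) = p \<gamma> \<gamma> (w \<gamma>)"
    proof (rule follows_unique[where z = "\<lambda>\<beta>. p \<beta> \<delta> (w \<delta>)" and z' = "\<lambda>\<beta>. p \<beta> \<gamma> (w \<gamma>)"])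
      show "ofilter (under \<gamma>)"
        by (rule under_ofilter)
      show "thread (under \<gamma>) (\<lambda>\<beta>. p \<beta> \<gamma> (w \<gamma>))"
        using thread_of_point w(1) \<gamma> that by blast
      show "thread (under \<gamma>) (\<lambda>\<beta>. p \<beta> \<delta> (w \<delta>))"
        using thread_subset[OF thread_of_point sub] w(1) \<gamma> that(1) le by blast
      show "follows \<alpha> (under \<gamma>) (\<lambda>\<beta>. p \<beta> \<gamma> (w \<gamma>))"
        using w(3) \<gamma> that by blast
      show "follows \<alpha> (under \<gamma>) (\<lambda>\<beta>. p \<beta> \<delta> (w \<delta>))"
        using follows_mono[OF w(3) _ sub] that(1) le le_refl[OF \<alpha>] by blast
      show "p \<alpha> \<delta> (w \<delta>) = p \<alpha> \<gamma> (w \<gamma>)"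
        using w(2) that le \<gamma> by simp
    qed (use that \<gamma> le_refl in \<open>auto simp: under_def\<close>)
    then show ?thesis
      using p_id w(1) \<gamma> that by simp
  qed
  \<comment> \<open>Indices not above \<open>\<alpha>\<close> lie strictly below it, and there the
    values are forced by \<open>y\<close>.\<close>
  define z where "z \<gamma> = (if \<alpha> \<sqsubseteq> \<gamma> then w \<gamma> else p \<gamma> \<alpha> y)" for \<gamma>
  have w\<alpha>: "w \<alpha> = y"
    using w(1,2)[OF A(2) le_refl[OF \<alpha>]] p_id[OF \<alpha>] by simp
  show thesis
  proof
    show "z \<alpha> = y"
      using w\<alpha> le_refl[OF \<alpha>] by (simp add: z_def)
    show "thread A z"
      unfolding thread_def
    proof (intro ballI conjI allI impI)
      fix \<gamma> assume \<gamma>: "\<gamma> \<in> A"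
      then have \<gamma>F: "\<gamma> \<in> Field r"
        using ofilter_Field A(1) by blast
      have \<gamma>\<alpha>: "\<gamma> \<sqsubseteq> \<alpha>" if "\<not> \<alpha> \<sqsubseteq> \<gamma>"
        using not_le[OF \<alpha> \<gamma>F that] by (simp add: lt_iff)
      show "z \<gamma> \<in> topspace (K \<gamma>)"
        using w(1)[OF \<gamma>] p_in[OF \<gamma>\<alpha> y] by (simp add: z_def)
      fix \<beta> assume \<beta>: "\<beta> \<sqsubseteq> \<gamma>"
      show "p \<beta> \<gamma> (z \<gamma>) = z \<beta>"
      proof (cases "\<alpha> \<sqsubseteq> \<gamma>")
        case True
        show ?thesis
        proof (cases "\<alpha> \<sqsubseteq> \<beta>")
          case True
          then show ?thesis
            using coh[OF \<gamma> True \<beta>] \<open>\<alpha> \<sqsubseteq> \<gamma>\<close> by (simp add: z_def)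
        next
          case False
          then have "\<beta> \<sqsubseteq> \<alpha>"
            using not_le[OF \<alpha> _ False] le_Field[OF \<beta>] by (simp add: lt_iff)
          then show ?thesis
            using p_p[OF _ True w(1)[OF \<gamma> True]] w(2)[OF \<gamma> True] True False
            by (simp add: z_def)
        qed
      next
        case False
        then have "\<not> \<alpha> \<sqsubseteq> \<beta>"
          using \<beta> le_trans by blast
        then show ?thesis
          using False p_p[OF \<beta> \<gamma>\<alpha>[OF False] y] by (simp add: z_def)
      qed
    qed
    show "follows \<alpha> A z"
      unfolding follows_def
    proof (intro allI impI, elim conjE)
      fix \<beta> assume \<beta>: "\<beta> \<in> Field r" "aboveS \<beta> \<noteq> {}" "\<alpha> \<sqsubseteq> \<beta>" "\<sigma> \<beta> \<in> A"
      then have lt: "\<beta> \<sqsubseteq> \<sigma> \<beta>"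
        using lt_next by (auto simp: lt_iff)
      have le: "\<alpha> \<sqsubseteq> \<sigma> \<beta>"
        using le_trans[OF \<beta>(3) lt] .
      have F: "\<sigma> \<beta> \<in> Field r"
        using le_Field[OF lt] by simp
      have "p (\<sigma> \<beta>) (\<sigma> \<beta>) (w (\<sigma> \<beta>)) = s \<beta> (p \<beta> (\<sigma> \<beta>) (w (\<sigma> \<beta>)))"
        using followsD[OF w(3)[OF \<beta>(4) le] _ \<beta>(3)] \<beta> le_refl[OF F] by (simp add: under_def)
      then show "z (\<sigma> \<beta>) = s \<beta> (z \<beta>)"
        using coh[OF \<beta>(4) \<beta>(3) lt] p_id[OF F w(1)[OF \<beta>(4) le]] \<beta>(3) le by (simp add: z_def)
    qed
  qed
qed

text \<open>Start with \<open>y\<close> at \<open>\<alpha>\<close>, apply the section at each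
  successor, and at a limit glue the extensions obtained so far and take the point representing the
  resulting thread.\<close>

lemma point_extension:
  assumes "\<delta> \<in> Field r" "\<alpha> \<sqsubseteq> \<delta>" and y: "y \<in> topspace (K \<alpha>)"
  shows "\<exists>x\<in>topspace (K \<delta>). p \<alpha> \<delta> x = y \<and> follows \<alpha> (under \<delta>) (\<lambda>\<gamma>. p \<gamma> \<delta> x)"
  using assms(1,2)
proof (induction \<delta> rule: ord_induct)
  have \<alpha>: "\<alpha> \<in> Field r"
    using le_Field[OF assms(2)] by simp
  \<comment> \<open>The index \<open>\<alpha>\<close> may itself be zero, a successor or a limit, so
    the starting point is treated once for all three cases of the induction.\<close>
  have base: "\<exists>x\<in>topspace (K \<delta>). p \<alpha> \<delta> x = y \<and> follows \<alpha> (under \<delta>) (\<lambda>\<gamma>. p \<gamma> \<delta> x)"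
    if "\<delta> = \<alpha>" for \<delta>
  proof (intro bexI conjI)
    show "y \<in> topspace (K \<delta>)" "p \<alpha> \<delta> y = y"
      using y that p_id[OF \<alpha>] by auto
    \<comment> \<open>A step that begins at or above \<open>\<alpha>\<close> ends strictly above it,
      so nothing has to be followed on \<open>under \<alpha>\<close>.\<close>
    have "\<not> (has_next \<beta> \<and> \<alpha> \<sqsubseteq> \<beta> \<and> \<sigma> \<beta> \<sqsubseteq> \<alpha>)" for \<beta>
      using lt_next le_antisym le_trans unfolding lt_iff by metis
    then show "follows \<alpha> (under \<delta>) (\<lambda>\<gamma>. p \<gamma> \<delta> y)"
      by (auto simp: follows_def under_def that)
  qed
  {
    case zero
    then show ?case
      using base le_antisym zero_le[OF \<alpha>] by blast
  next
    case (succ \<beta>)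
    show ?case
    proof (cases "\<sigma> \<beta> = \<alpha>")
      case False
      then have \<alpha>\<beta>: "\<alpha> \<sqsubseteq> \<beta>"
        using succ.prems lt_next_iff[OF succ.hyps] by (auto simp: lt_iff)
      obtain x where x: "x \<in> topspace (K \<beta>)" "p \<alpha> \<beta> x = y"
          "follows \<alpha> (under \<beta>) (\<lambda>\<gamma>. p \<gamma> \<beta> x)"
        using succ.IH[OF \<alpha>\<beta>] by blast
      have lt: "\<beta> \<sqsubseteq> \<sigma> \<beta>" and F: "\<sigma> \<beta> \<in> Field r"
        using lt_next[OF succ.hyps] le_Field by (auto simp: lt_iff)
      let ?x = "s \<beta> x"
      have sx: "?x \<in> topspace (K (\<sigma> \<beta>))"
        using s_in[OF succ.hyps x(1)] .
      \<comment> \<open>The new point lies over \<open>x\<close>, so its projections to old indices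
        are unchanged; only the last step, from \<open>\<beta>\<close> to
        \<open>\<sigma> \<beta>\<close>, has to be examined anew.\<close>
      have px: "p \<gamma> (\<sigma> \<beta>) ?x = p \<gamma> \<beta> x" if "\<gamma> \<sqsubseteq> \<beta>" for \<gamma>
        using p_p[OF that lt sx] p_s[OF succ.hyps x(1)] by simp
      have "follows \<alpha> (under (\<sigma> \<beta>)) (\<lambda>\<gamma>. p \<gamma> (\<sigma> \<beta>) ?x)"
        unfolding follows_def
      proof (intro allI impI, elim conjE)
        fix \<gamma> assume \<gamma>: "\<gamma> \<in> Field r" "aboveS \<gamma> \<noteq> {}" "\<alpha> \<sqsubseteq> \<gamma>" "\<sigma> \<gamma> \<in> under (\<sigma> \<beta>)"
        show "p (\<sigma> \<gamma>) (\<sigma> \<beta>) ?x = s \<gamma> (p \<gamma> (\<sigma> \<beta>) ?x)"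
        proof (cases "\<sigma> \<gamma> = \<sigma> \<beta>")
          case True
          then have "\<gamma> = \<beta>"
            using next_inj \<gamma> succ.hyps by blast
          then show ?thesis
            using px[OF le_refl] \<gamma>(1) p_id[OF F sx] p_id[OF \<gamma>(1)] x(1) by simp
        next
          case False
          then have 1: "\<sigma> \<gamma> \<sqsubseteq> \<beta>"
            using \<gamma>(4) lt_next_iff[OF succ.hyps] by (auto simp: lt_iff under_def)
          then have 2: "\<gamma> \<sqsubseteq> \<beta>"
            using lt_next \<gamma>(1,2) le_trans by (auto simp: lt_iff)
          show ?thesis
            using followsD[OF x(3) _ \<gamma>(3)] \<gamma> 1 px[OF 1] px[OF 2] by (simp add: under_def)
        qed
      qed
      then show ?thesis
        using sx px[OF \<alpha>\<beta>] x(2) by auto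
    qed (rule base)
  next
    case (limit \<delta>)
    show ?case
    proof (cases "\<delta> = \<alpha>")
      case False
      then have \<alpha>\<delta>: "\<alpha> \<sqsubset> \<delta>"
        using limit.prems by (simp add: lt_iff)
      obtain z where z: "thread (underS \<delta>) z" "z \<alpha> = y" "follows \<alpha> (underS \<delta>) z"
        using glue_threads[OF underS_ofilter \<alpha>\<delta> y limit.IH] by blast
      obtain x where x: "x \<in> topspace (K \<delta>)" "\<And>\<beta>. \<beta> \<sqsubset> \<delta> \<Longrightarrow> p \<beta> \<delta> x = z \<beta>"
        using limit_point_exists[OF limit.hyps z(1)] by blast
      have "follows \<alpha> (under \<delta>) (\<lambda>\<gamma>. p \<gamma> \<delta> x)"
        unfolding follows_def
      proof (intro allI impI, elim conjE)
        fix \<beta> assume \<beta>: "\<beta> \<in> Field r" "aboveS \<beta> \<noteq> {}" "\<alpha> \<sqsubseteq> \<beta>" "\<sigma> \<beta> \<in> under \<delta>"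
        have "\<beta> \<sqsubset> \<sigma> \<beta>"
          using lt_next \<beta>(1,2) by blast
        then have 1: "\<beta> \<sqsubset> \<delta>"
          using \<beta>(4) le_trans le_antisym by (auto simp: lt_iff under_def)
        \<comment> \<open>A limit is not a successor, so every step in question ends below
          \<open>\<delta>\<close>, where the glued thread \<open>z\<close> decides.\<close>
        then have 2: "\<sigma> \<beta> \<sqsubset> \<delta>"
          by (rule next_lt_limit[OF limit.hyps])
        show "p (\<sigma> \<beta>) \<delta> x = s \<beta> (p \<beta> \<delta> x)"
          using followsD[OF z(3) _ \<beta>(3) 2] \<beta> x(2)[OF 1] x(2)[OF 2] by simp
      qed
      then show ?thesis
        using x z(2) \<alpha>\<delta> by auto
    qed (rule base)
  }
qed

lemma thread_extension:
  assumes "\<alpha> \<in> Field r" "y \<in> topspace (K \<alpha>)"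
  obtains z where "thread (Field r) z" "z \<alpha> = y" "follows \<alpha> (Field r) z"
  using glue_threads[OF Field_ofilter assms] point_extension[OF _ _ assms(2)] by metis

section \<open>Basic open sets of inverse limits\<close>

lemma finite_le_max:
  assumes "finite F" "F \<noteq> {}" "F \<subseteq> Field r"
  shows "\<exists>m\<in>F. \<forall>a\<in>F. a \<sqsubseteq> m"
  using assms
proof (induction F rule: finite_ne_induct)
  case (singleton x)
  then show ?case using le_refl by auto
next
  case (insert x F)
  then obtain m where m: "m \<in> F" "\<forall>a\<in>F. a \<sqsubseteq> m" by auto
  have x: "x \<in> Field r" "x \<sqsubseteq> x" and mF: "m \<in> Field r"
    using insert.prems m(1) le_refl by auto
  show ?case
  proof (cases "x \<sqsubseteq> m")
    case True
    then show ?thesis using m by blast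
  next
    case False
    then have "m \<sqsubseteq> x"
      using not_le[OF x(1) mF] by (simp add: lt_iff)
    then have "\<forall>a\<in>F. a \<sqsubseteq> x"
      using m(2) le_trans by blast
    then show ?thesis using x(2) by blast
  qed
qed

text \<open>A basic open set of the product restricts finitely many coordinates. Along a thread all
  of them are determined by the coordinate at the largest index involved, so the conditions pull
  back to one open set there.\<close>

lemma inverse_limit_basis:
  assumes A: "ofilter A" "A \<noteq> {}"
    and U: "openin (inverse_limit (Restr r A) K p) U" "x \<in> U"
  shows "\<exists>\<alpha>\<in>A. \<exists>V. openin (K \<alpha>) V \<and> x \<alpha> \<in> V \<and>
    (\<forall>z. z \<in> extensional A \<and> thread A z \<and> z \<alpha> \<in> V \<longrightarrow> z \<in> U)"
proof -
  have x: "thread A x"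
    using openin_subset[OF U(1)] U(2) topspace_limit[OF A(1)] by auto
  obtain T where T: "openin (product_topology K A) T"
      "U = T \<inter> {x. \<forall>(\<alpha>, \<beta>)\<in>Restr r A. p \<alpha> \<beta> (x \<beta>) = x \<alpha>}"
    using U(1) by (auto simp: inverse_limit_def openin_subtopology Field_Restr[OF A(1)])
  then obtain W where W: "finite {i \<in> A. W i \<noteq> topspace (K i)}" "\<And>i. i \<in> A \<Longrightarrow> openin (K i) (W i)"
      "x \<in> PiE A W" "PiE A W \<subseteq> T"
    using U(2) by (auto simp: openin_product_topology_alt)
  obtain a where a: "a \<in> A"
    using A(2) by blast
  \<comment> \<open>Inserting \<open>a\<close> keeps \<open>F\<close> nonempty, so that it has a
    maximum even if no coordinate is restricted.\<close>
  define F where "F = insert a {i \<in> A. W i \<noteq> topspace (K i)}"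
  have F: "finite F" "F \<subseteq> A" "F \<noteq> {}"
    using W(1) a by (auto simp: F_def)
  then obtain m where m: "m \<in> F" "\<And>i. i \<in> F \<Longrightarrow> i \<sqsubseteq> m"
    using finite_le_max[of F] ofilter_Field[OF A(1)] by blast
  then have mA: "m \<in> A"
    using F by blast
  define V where "V = (\<Inter>i\<in>F. {y \<in> topspace (K m). p i m y \<in> W i})"
  show ?thesis
  proof (intro bexI exI conjI allI impI)
    show "m \<in> A"
      by (rule mA)
    show "openin (K m) V"
      unfolding V_def using F W(2) m p_continuous
      by (intro openin_INT2) (auto intro!: openin_continuous_map_preimage)
    show "x m \<in> V"
      unfolding V_def using thread_in[OF x mA] thread_p[OF x mA m(2)] W(3) F by auto
    fix z assume "z \<in> extensional A \<and> thread A z \<and> z m \<in> V"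
    then have z: "z \<in> extensional A" "thread A z" "z m \<in> V"
      by auto
    have "z i \<in> W i" if "i \<in> A" for i
    proof (cases "i \<in> F")
      case True
      then show ?thesis
        using z(3) thread_p[OF z(2) mA m(2)] by (auto simp: V_def)
    next
      case False
      then show ?thesis
        using thread_in[OF z(2) that] that by (auto simp: F_def)
    qed
    then have "z \<in> PiE A W"
      using z(1) by (simp add: PiE_iff)
    then have "z \<in> T"
      using W(4) by blast
    then show "z \<in> U"
      using z(2) thread_p by (auto simp: T(2))
  qed
qed

text \<open>This transports \<open>inverse_limit_basis\<close> to \<open>K \<delta>\<close> along
  the homeomorphism that continuity provides; nonemptiness of \<open>V'\<close> comes from the
  projection of a point of \<open>V\<close>.\<close>

lemma limit_basis:
  assumes "ord_limit r \<delta>" and V: "openin (K \<delta>) V" "V \<noteq> {}"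
  obtains \<alpha> V' where "\<alpha> \<sqsubset> \<delta>" "openin (K \<alpha>) V'" "V' \<noteq> {}"
    "\<And>y. y \<in> topspace (K \<delta>) \<Longrightarrow> p \<alpha> \<delta> y \<in> V' \<Longrightarrow> y \<in> V"
proof -
  define h where "h x = (\<lambda>\<alpha>\<in>underS \<delta>. p \<alpha> \<delta> x)" for x
  let ?L = "inverse_limit (Restr r (underS \<delta>)) K p"
  have hm: "homeomorphic_map (K \<delta>) ?L h"
    using limit_homeomorphism[OF assms(1)] by (simp add: h_def[abs_def])
  obtain x where x: "x \<in> V"
    using V(2) by blast
  have of: "ofilter (underS \<delta>)"
    by (rule underS_ofilter)
  have "openin ?L (h ` V)"
    using homeomorphic_map_openness[OF hm openin_subset[OF V(1)]] V(1) by simp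
  moreover have "underS \<delta> \<noteq> {}"
    using zero_lt_limit[OF assms(1)] by blast
  ultimately obtain \<alpha> V' where \<alpha>: "\<alpha> \<sqsubset> \<delta>" "openin (K \<alpha>) V'" "h x \<alpha> \<in> V'"
      "\<forall>z. z \<in> extensional (underS \<delta>) \<and> thread (underS \<delta>) z \<and> z \<alpha> \<in> V' \<longrightarrow> z \<in> h ` V"
    using inverse_limit_basis[OF of _ _ imageI[OF x]] by blast
  show thesis
  proof
    show "\<alpha> \<sqsubset> \<delta>" "openin (K \<alpha>) V'" "V' \<noteq> {}"
      using \<alpha> by auto
    fix y assume y: "y \<in> topspace (K \<delta>)" "p \<alpha> \<delta> y \<in> V'"
    have "h y \<in> topspace ?L"
      using hm y(1) by (auto simp: homeomorphic_eq_everything_map)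
    then have "h y \<in> h ` V"
      using \<alpha>(1,4) y(2) by (simp add: topspace_limit[OF of] h_def)
    then obtain v where v: "v \<in> V" "h y = h v"
      by blast
    have "inj_on h (topspace (K \<delta>))"
      using hm by (simp add: homeomorphic_eq_everything_map)
    then show "y \<in> V"
      using v y(1) openin_subset[OF V(1)] by (metis inj_onD subsetD)
  qed
qed

end

section \<open>The embedding into a real power\<close>

locale semi_Eberlein_retractive_sequence = retractive_sequence r K p s
  for r :: "'i rel" and K :: "'i \<Rightarrow> 'a topology" and p :: "'i \<Rightarrow> 'i \<Rightarrow> 'a \<Rightarrow> 'a" and s +
  fixes S :: "'s set" and h :: "'a \<Rightarrow> 's \<Rightarrow> real" and g :: "'i \<Rightarrow> 'a \<Rightarrow> nat \<Rightarrow> real"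
  assumes K_compact_Hausdorff: "\<And>\<alpha>. \<alpha> \<in> Field r \<Longrightarrow> compact_space (K \<alpha>) \<and> Hausdorff_space (K \<alpha>)"
    and h_embedding: "semi_Eberlein_embedding (K (ord_zero r)) S h"
    and semi_open: "\<And>\<alpha>. has_next \<alpha> \<Longrightarrow> semi_open_map (K (\<sigma> \<alpha>)) (K \<alpha>) (p \<alpha> (\<sigma> \<alpha>))"
    and g_continuous: "\<And>\<alpha>. has_next \<alpha> \<Longrightarrow>
      continuous_map (K (\<sigma> \<alpha>)) (product_topology (\<lambda>_. top_of_set {0..1}) UNIV) (g \<alpha>)"
    and g_inj: "\<And>\<alpha>. has_next \<alpha> \<Longrightarrow>
      inj_on (\<lambda>x. (p \<alpha> (\<sigma> \<alpha>) x, g \<alpha> x)) (topspace (K (\<sigma> \<alpha>)))"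
begin

text \<open>
  Subtracting the value on the section makes the kernel coordinates vanish on the image of
  \<open>s \<alpha>\<close>; dividing by \<open>n + 1\<close> puts each of these sequences into \<open>c0\<close>.
\<close>

definition kernel :: "'i \<Rightarrow> nat \<Rightarrow> 'a \<Rightarrow> real" where
  "kernel \<alpha> n x = (g \<alpha> x n - g \<alpha> (s \<alpha> (p \<alpha> (\<sigma> \<alpha>) x)) n) / (real n + 1)"

section \<open>Properties of the kernel coordinates\<close>

lemma next_props: "has_next \<alpha> \<Longrightarrow> \<alpha> \<sqsubseteq> \<sigma> \<alpha> \<and> \<sigma> \<alpha> \<in> Field r"
  using lt_next[of \<alpha>] le_Field[of \<alpha> "\<sigma> \<alpha>"] by (auto simp: lt_iff)

lemma g_component_continuous:
  assumes "has_next \<alpha>"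
  shows "continuous_map (K (\<sigma> \<alpha>)) (top_of_set {0..1}) (\<lambda>x. g \<alpha> x n)"
  using g_continuous[OF assms] by (simp add: continuous_map_componentwise_UNIV)

lemma g_bounds:
  assumes "has_next \<alpha>" "x \<in> topspace (K (\<sigma> \<alpha>))"
  shows "g \<alpha> x n \<in> {0..1}"
  using continuous_map_image_subset_topspace[OF g_component_continuous[OF assms(1), of n]] assms(2)
  by auto

lemma kernel_continuous:
  assumes "has_next \<alpha>"
  shows "continuous_map (K (\<sigma> \<alpha>)) euclideanreal (kernel \<alpha> n)"
proof -
  have g: "continuous_map (K (\<sigma> \<alpha>)) euclideanreal (\<lambda>x. g \<alpha> x n)"
    using g_component_continuous[OF assms] continuous_map_into_fulltopology by blast
  have "continuous_map (K (\<sigma> \<alpha>)) (K (\<sigma> \<alpha>)) (s \<alpha> \<circ> p \<alpha> (\<sigma> \<alpha>))"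
    using p_continuous s_continuous[OF assms] next_props[OF assms]
    by (blast intro: continuous_map_compose)
  then have "continuous_map (K (\<sigma> \<alpha>)) euclideanreal ((\<lambda>x. g \<alpha> x n) \<circ> (s \<alpha> \<circ> p \<alpha> (\<sigma> \<alpha>)))"
    using g by (rule continuous_map_compose)
  then have "continuous_map (K (\<sigma> \<alpha>)) euclideanreal
      (\<lambda>x. (g \<alpha> x n - g \<alpha> (s \<alpha> (p \<alpha> (\<sigma> \<alpha>) x)) n) * inverse (real n + 1))"
    using g by (intro continuous_map_real_mult_right continuous_map_diff) (simp_all add: o_def)
  then show ?thesis
    by (simp add: kernel_def[abs_def] divide_inverse)
qed

text \<open>Two numbers in \<open>{0..1}\<close> differ by at most 1. The bound tends to 0 with
  \<open>n\<close> regardless of \<open>x\<close>, so a single step contributes only finitely many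
  coordinates above any positive threshold.\<close>

lemma kernel_bound:
  assumes "has_next \<alpha>" "x \<in> topspace (K (\<sigma> \<alpha>))"
  shows "\<bar>kernel \<alpha> n x\<bar> \<le> 1 / (real n + 1)"
proof -
  have "s \<alpha> (p \<alpha> (\<sigma> \<alpha>) x) \<in> topspace (K (\<sigma> \<alpha>))"
    using s_in[OF assms(1)] p_in assms(2) next_props[OF assms(1)] by blast
  then have "\<bar>g \<alpha> x n - g \<alpha> (s \<alpha> (p \<alpha> (\<sigma> \<alpha>) x)) n\<bar> \<le> 1"
    using g_bounds[OF assms, of n] g_bounds[OF assms(1), of _ n] by (fastforce simp: abs_le_iff)
  then show ?thesis
    by (simp add: kernel_def divide_right_mono)
qed

text \<open>The point \<open>s \<alpha> y\<close> projects to \<open>y\<close>, so the two terms of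
  the difference coincide.\<close>

lemma kernel_section:
  assumes "has_next \<alpha>" "y \<in> topspace (K \<alpha>)"
  shows "kernel \<alpha> n (s \<alpha> y) = 0"
  using p_s[OF assms] by (simp add: kernel_def)

text \<open>The subtracted term depends only on the projection to \<open>K \<alpha>\<close>. Over a
  common projection, equal normalised coordinates thus give equal values of
  \<open>g \<alpha>\<close>, which separates such points.\<close>

lemma kernel_inj:
  assumes \<alpha>: "has_next \<alpha>" and x: "x \<in> topspace (K (\<sigma> \<alpha>))" "x' \<in> topspace (K (\<sigma> \<alpha>))"
    and eq: "p \<alpha> (\<sigma> \<alpha>) x = p \<alpha> (\<sigma> \<alpha>) x'" "\<And>n. kernel \<alpha> n x = kernel \<alpha> n x'"
  shows "x = x'"
proof -
  have "g \<alpha> x n = g \<alpha> x' n" for n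
    using eq(2)[of n] by (simp add: kernel_def eq(1) divide_simps split: if_splits)
  then have "g \<alpha> x = g \<alpha> x'"
    by blast
  then show ?thesis
    using g_inj[OF \<alpha>] x eq(1) by (simp add: inj_on_def)
qed

section \<open>Threads with image in \<open>c0\<close> and their density\<close>

definition kernel_coordinates :: "real \<Rightarrow> ('i \<Rightarrow> 'a) \<Rightarrow> ('i \<times> nat) set" where
  "kernel_coordinates \<epsilon> z = {(\<beta>, n). has_next \<beta> \<and> \<bar>kernel \<beta> n (z (\<sigma> \<beta>))\<bar> > \<epsilon>}"

text \<open>Membership of the future image in \<open>c0\<close> is split into its base part and its
  kernel part, because the induction changes them separately.\<close>

definition c0_thread :: "('i \<Rightarrow> 'a) \<Rightarrow> bool" where
  "c0_thread z \<longleftrightarrow> thread (Field r) z \<and> h (z (ord_zero r)) \<in> c0 S \<and>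
     (\<forall>\<epsilon>>0. finite (kernel_coordinates \<epsilon> z))"

text \<open>From \<open>\<alpha>\<close> on, the values at successors lie in the images of the
  sections, where the kernel coordinates vanish.\<close>

lemma kernel_follows:
  assumes "thread (Field r) z" "follows \<alpha> (Field r) z" "has_next \<beta>" "\<alpha> \<sqsubseteq> \<beta>"
  shows "kernel \<beta> n (z (\<sigma> \<beta>)) = 0"
  using followsD[OF assms(2,3,4)] kernel_section[OF assms(3)] thread_in[OF assms(1)]
    next_props[OF assms(3)] assms(3) by simp

lemma finite_reciprocals_gt:
  assumes "\<epsilon> > 0"
  shows "finite {n::nat. 1 / (real n + 1) > \<epsilon>}"
proof (rule finite_subset)
  show "{n::nat. 1 / (real n + 1) > \<epsilon>} \<subseteq> {..nat \<lceil>1 / \<epsilon>\<rceil>}"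
  proof
    fix n :: nat assume "n \<in> {n. 1 / (real n + 1) > \<epsilon>}"
    then have "real n \<le> 1 / \<epsilon>"
      using assms by (simp add: field_simps)
    then show "n \<in> {..nat \<lceil>1 / \<epsilon>\<rceil>}"
      by (simp add: le_nat_iff) linarith
  qed
qed simp

text \<open>Coordinates of steps before \<open>\<beta>\<close> are those of \<open>z\<close>,
  coordinates of later steps are zero, and the step at \<open>\<beta>\<close> adds one null
  sequence.\<close>

lemma c0_thread_successor:
  assumes \<beta>: "has_next \<beta>" and z: "c0_thread z"
    and z': "thread (Field r) z'" "follows (\<sigma> \<beta>) (Field r) z'" "z' \<beta> = z \<beta>"
  shows "c0_thread z'"
proof -
  have zt: "thread (Field r) z"
    using z by (simp add: c0_thread_def)
  have \<beta>F: "\<beta> \<in> Field r"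
    using \<beta> by simp
  have agree: "z' \<gamma> = z \<gamma>" if "\<gamma> \<sqsubseteq> \<beta>" for \<gamma>
    using thread_p[OF zt \<beta>F that] thread_p[OF z'(1) \<beta>F that] z'(3) by simp
  have "finite (kernel_coordinates \<epsilon> z')" if \<epsilon>: "\<epsilon> > 0" for \<epsilon>
  proof (rule finite_subset)
    show "kernel_coordinates \<epsilon> z' \<subseteq>
        kernel_coordinates \<epsilon> z \<union> {\<beta>} \<times> {n. 1 / (real n + 1) > \<epsilon>}"
    proof (rule subrelI, rule UnCI)
      fix \<gamma> n
      assume "(\<gamma>, n) \<in> kernel_coordinates \<epsilon> z'"
        and out: "(\<gamma>, n) \<notin> {\<beta>} \<times> {n. 1 / (real n + 1) > \<epsilon>}"
      then have \<gamma>: "has_next \<gamma>" "\<bar>kernel \<gamma> n (z' (\<sigma> \<gamma>))\<bar> > \<epsilon>"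
        by (auto simp: kernel_coordinates_def)
      have "\<epsilon> < 1 / (real n + 1)"
        using kernel_bound[OF \<gamma>(1) thread_in[OF z'(1)], of n] next_props[OF \<gamma>(1)] \<gamma>(2) by fastforce
      then have "\<gamma> \<noteq> \<beta>"
        using out by simp
      have "\<not> \<sigma> \<beta> \<sqsubseteq> \<gamma>"
        using kernel_follows[OF z'(1,2) \<gamma>(1)] \<gamma>(2) \<epsilon> by fastforce
      then have "\<gamma> \<sqsubseteq> \<beta>"
        using not_le[of "\<sigma> \<beta>" \<gamma>] next_props[OF \<beta>] \<gamma>(1) lt_next_iff[OF \<beta>] by blast
      with \<open>\<gamma> \<noteq> \<beta>\<close> have "\<gamma> \<sqsubset> \<beta>"
        by (simp add: lt_iff)
      \<comment> \<open>Strictness of \<open>\<gamma> \<sqsubset> \<beta>\<close> matters: the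
        coordinate is read at \<open>\<sigma> \<gamma>\<close>, which must still be at or below
        \<open>\<beta>\<close> for the two threads to agree there.\<close>
      then show "(\<gamma>, n) \<in> kernel_coordinates \<epsilon> z"
        using agree[OF next_le] \<gamma> by (simp add: kernel_coordinates_def)
    qed
    show "finite (kernel_coordinates \<epsilon> z \<union> {\<beta>} \<times> {n. 1 / (real n + 1) > \<epsilon>})"
      using z \<epsilon> finite_reciprocals_gt[OF \<epsilon>] by (auto simp: c0_thread_def)
  qed
  moreover have "h (z' (ord_zero r)) \<in> c0 S"
    using z agree[OF zero_le[OF \<beta>F]] by (simp add: c0_thread_def)
  ultimately show ?thesis
    using z'(1) by (simp add: c0_thread_def)
qed

lemma h_map: "embedding_map (K (ord_zero r)) (powertop_real S) h"
  using h_embedding by (simp add: semi_Eberlein_embedding_def)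

lemma h_dense:
  assumes "openin (K (ord_zero r)) V" "V \<noteq> {}"
  obtains y where "y \<in> V" "h y \<in> c0 S"
proof -
  let ?D = "{x \<in> topspace (K (ord_zero r)). h x \<in> c0 S}"
  have "K (ord_zero r) closure_of ?D = topspace (K (ord_zero r))"
    using h_embedding by (simp add: semi_Eberlein_embedding_dense[OF h_map])
  then have "?D \<inter> V \<noteq> {}"
    using assms by (simp add: dense_intersects_open)
  then show thesis
    using that by blast
qed

text \<open>The induction runs over all open sets at once, since the successor and limit cases use
  the hypothesis for open sets in an earlier space.\<close>

lemma c0_thread_dense:
  assumes "\<alpha> \<in> Field r" "openin (K \<alpha>) V" "V \<noteq> {}"
  shows "\<exists>z. c0_thread z \<and> z \<alpha> \<in> V \<and> follows \<alpha> (Field r) z"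
  using assms
proof (induction \<alpha> arbitrary: V rule: ord_induct)
  case zero
  then obtain y where y: "y \<in> V" "h y \<in> c0 S"
    using h_dense by blast
  then have "y \<in> topspace (K (ord_zero r))"
    using openin_subset[OF zero(1)] by blast
  then obtain z where z: "thread (Field r) z" "z (ord_zero r) = y" "follows (ord_zero r) (Field r) z"
    using thread_extension[OF zero_in] by metis
  \<comment> \<open>A thread following the sections from zero on has no nonzero kernel coordinate,
    so only the base point has to be in \<open>c0\<close>.\<close>
  have "kernel \<beta> n (z (\<sigma> \<beta>)) = 0" if "has_next \<beta>" for \<beta> n
    using kernel_follows[OF z(1,3) that zero_le] that by simp
  then have "kernel_coordinates \<epsilon> z = {}" if "\<epsilon> > 0" for \<epsilon>
    using that unfolding kernel_coordinates_def by fastforce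
  then have "c0_thread z"
    using z y by (simp add: c0_thread_def)
  then show ?case
    using z y by blast
next
  case (succ \<beta>)
  \<comment> \<open>Semi-openness makes \<open>?W\<close> nonempty. A thread through
    \<open>?W\<close> passes through the image of some \<open>v\<close> in \<open>V\<close>;
    restarting from \<open>v\<close> changes its value at \<open>\<sigma> \<beta>\<close> while
    keeping the one at \<open>\<beta>\<close>.\<close>
  let ?W = "K \<beta> interior_of (p \<beta> (\<sigma> \<beta>) ` V)"
  have "?W \<noteq> {}"
    using semi_open[OF succ.hyps] succ.prems by (simp add: semi_open_map_def)
  then obtain z where z: "c0_thread z" "z \<beta> \<in> ?W"
    using succ.IH[OF openin_interior_of] by blast
  then obtain v where v: "v \<in> V" "z \<beta> = p \<beta> (\<sigma> \<beta>) v"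
    using interior_of_subset[of "K \<beta>"] by blast
  have vK: "v \<in> topspace (K (\<sigma> \<beta>))"
    using v(1) openin_subset[OF succ.prems(1)] by blast
  have n: "\<beta> \<sqsubseteq> \<sigma> \<beta>" "\<sigma> \<beta> \<in> Field r"
    using next_props[OF succ.hyps] by auto
  obtain z' where z': "thread (Field r) z'" "z' (\<sigma> \<beta>) = v" "follows (\<sigma> \<beta>) (Field r) z'"
    using thread_extension[OF n(2) vK] by metis
  have "z' \<beta> = z \<beta>"
    using thread_p[OF z'(1) n(2) n(1)] z'(2) v(2) by simp
  then have "c0_thread z'"
    using c0_thread_successor[OF succ.hyps z(1) z'(1,3)] by blast
  then show ?case
    using z' v(1) by blast
next
  case (limit \<delta>)
  obtain \<alpha> V' where \<alpha>: "\<alpha> \<sqsubset> \<delta>" "openin (K \<alpha>) V'" "V' \<noteq> {}"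
    "\<And>y. y \<in> topspace (K \<delta>) \<Longrightarrow> p \<alpha> \<delta> y \<in> V' \<Longrightarrow> y \<in> V"
    using limit_basis[OF limit.hyps limit.prems] by metis
  \<comment> \<open>Threads are defined on the whole field, so the one found at the earlier index
    serves unchanged at \<open>\<delta>\<close>.\<close>
  obtain z where z: "c0_thread z" "z \<alpha> \<in> V'" "follows \<alpha> (Field r) z"
    using limit.IH[OF \<alpha>(1-3)] by blast
  have le: "\<alpha> \<sqsubseteq> \<delta>" and \<delta>: "\<delta> \<in> Field r"
    using \<alpha>(1) limit.hyps by (auto simp: lt_iff ord_limit_def)
  have t: "thread (Field r) z"
    using z(1) by (simp add: c0_thread_def)
  have "z \<delta> \<in> V"
    using \<alpha>(4)[OF thread_in[OF t \<delta>]] thread_p[OF t \<delta> le] z(2) by simp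
  then show ?case
    using z(1) follows_mono[OF z(3) le subset_refl] by blast
qed

section \<open>The embedding of the limit\<close>

definition index_set :: "('s + 'i \<times> nat) set" where
  "index_set = S <+> {\<beta>. has_next \<beta>} \<times> UNIV"

text \<open>The restriction makes the value \<open>undefined\<close> off \<open>index_set\<close>,
  as for all points of \<open>powertop_real index_set\<close>.\<close>

definition embed :: "('i \<Rightarrow> 'a) \<Rightarrow> 's + 'i \<times> nat \<Rightarrow> real" where
  "embed z = (\<lambda>i\<in>index_set. case i of Inl a \<Rightarrow> h (z (ord_zero r)) a
     | Inr (\<beta>, n) \<Rightarrow> kernel \<beta> n (z (\<sigma> \<beta>)))"

lemma embed_Inl: "a \<in> S \<Longrightarrow> embed z (Inl a) = h (z (ord_zero r)) a"
  by (auto simp: embed_def index_set_def)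

lemma embed_Inr: "has_next \<beta> \<Longrightarrow> embed z (Inr (\<beta>, n)) = kernel \<beta> n (z (\<sigma> \<beta>))"
  by (auto simp: embed_def index_set_def)

lemma embed_c0:
  assumes "c0_thread z"
  shows "embed z \<in> c0 index_set"
proof -
  have "finite {i \<in> index_set. \<bar>embed z i\<bar> > \<epsilon>}" if \<epsilon>: "\<epsilon> > 0" for \<epsilon>
  proof (rule finite_subset)
    show "{i \<in> index_set. \<bar>embed z i\<bar> > \<epsilon>} \<subseteq>
        {a \<in> S. \<bar>h (z (ord_zero r)) a\<bar> > \<epsilon>} <+> kernel_coordinates \<epsilon> z"
    proof
      fix i assume i: "i \<in> {i \<in> index_set. \<bar>embed z i\<bar> > \<epsilon>}"
      then consider a where "i = Inl a" "a \<in> S" | \<beta> n where "i = Inr (\<beta>, n)" "has_next \<beta>"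
        unfolding index_set_def by blast
      then show "i \<in> {a \<in> S. \<bar>h (z (ord_zero r)) a\<bar> > \<epsilon>} <+> kernel_coordinates \<epsilon> z"
        using i by cases (simp_all add: embed_Inl embed_Inr kernel_coordinates_def InlI InrI)
    qed
    show "finite ({a \<in> S. \<bar>h (z (ord_zero r)) a\<bar> > \<epsilon>} <+> kernel_coordinates \<epsilon> z)"
      using assms \<epsilon> by (auto simp: c0_thread_def c0_def)
  qed
  then show ?thesis
    by (auto simp: c0_def embed_def)
qed

lemma topspace_inverse_limit:
  "topspace (inverse_limit r K p) = {z \<in> extensional (Field r). thread (Field r) z}"
  using topspace_limit[OF Field_ofilter] by (simp add: Restr_Field)

lemma projection_continuous:
  assumes "\<alpha> \<in> Field r"
  shows "continuous_map (inverse_limit r K p) (K \<alpha>) (\<lambda>z. z \<alpha>)"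
  unfolding inverse_limit_def
  using assms by (intro continuous_map_from_subtopology continuous_map_product_projection)

lemma h_continuous: "continuous_map (K (ord_zero r)) (powertop_real S) h"
proof -
  have "homeomorphic_map (K (ord_zero r))
      (subtopology (powertop_real S) (h ` topspace (K (ord_zero r)))) h"
    using h_map by (simp add: embedding_map_def)
  then show ?thesis
    using homeomorphic_imp_continuous_map continuous_map_into_fulltopology by blast
qed

lemma embed_continuous: "continuous_map (inverse_limit r K p) (powertop_real index_set) embed"
  unfolding continuous_map_componentwise
proof (intro conjI ballI)
  fix i assume i: "i \<in> index_set"
  show "continuous_map (inverse_limit r K p) euclideanreal (\<lambda>z. embed z i)"
  proof (cases i)
    case (Inl a)
    then have a: "a \<in> S"
      using i by (auto simp: index_set_def)
    have "continuous_map (K (ord_zero r)) euclideanreal (\<lambda>x. h x a)"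
      using a h_continuous by (simp add: continuous_map_componentwise)
    from continuous_map_compose[OF projection_continuous[OF zero_in] this]
    show ?thesis
      using a by (simp add: Inl embed_Inl o_def)
  next
    case (Inr b)
    then obtain \<beta> n where b: "b = (\<beta>, n)" and \<beta>: "has_next \<beta>"
      using i by (auto simp: index_set_def)
    have "\<sigma> \<beta> \<in> Field r"
      using next_props[OF \<beta>] by simp
    from continuous_map_compose[OF projection_continuous[OF this] kernel_continuous[OF \<beta>, of n]]
    show ?thesis
      by (simp add: Inr b embed_Inr[OF \<beta>] o_def)
  qed
qed (auto simp: embed_def)

text \<open>The base coordinates determine the value at zero because \<open>h\<close> is injective.
  The kernel coordinates carry equality from \<open>\<beta>\<close> to
  \<open>\<sigma> \<beta>\<close>, and \<open>thread_determined\<close> does the rest.\<close>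

lemma embed_inj: "inj_on embed (topspace (inverse_limit r K p))"
proof (rule inj_onI)
  fix z z'
  assume "z \<in> topspace (inverse_limit r K p)" "z' \<in> topspace (inverse_limit r K p)"
    and eq: "embed z = embed z'"
  then have ext: "z \<in> extensional (Field r)" "z' \<in> extensional (Field r)"
    and t: "thread (Field r) z" "thread (Field r) z'"
    by (auto simp: topspace_inverse_limit)
  let ?o = "ord_zero r"
  have hm: "homeomorphic_map (K ?o) (subtopology (powertop_real S) (h ` topspace (K ?o))) h"
    using h_map by (simp add: embedding_map_def)
  have inj: "inj_on h (topspace (K ?o))"
    using hm by (simp add: homeomorphic_eq_everything_map)
  have hS: "h x \<in> extensional S" if "x \<in> topspace (K ?o)" for x
    using h_continuous that by (auto simp: continuous_map_componentwise)
  have "h (z ?o) = h (z' ?o)"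
  proof (rule extensionalityI)
    show "h (z ?o) \<in> extensional S" "h (z' ?o) \<in> extensional S"
      using hS thread_in[OF _ zero_in] t by auto
    show "h (z ?o) a = h (z' ?o) a" if "a \<in> S" for a
      using fun_cong[OF eq, of "Inl a"] that by (simp add: embed_Inl)
  qed
  then have z0: "z ?o = z' ?o"
    using inj thread_in[OF _ zero_in] t by (simp add: inj_on_eq_iff)
  show "z = z'"
  proof (rule extensionalityI[OF ext])
    fix \<gamma> assume "\<gamma> \<in> Field r"
    with Field_ofilter t zero_in z0 show "z \<gamma> = z' \<gamma>"
    proof (rule thread_determined)
      fix \<beta> assume \<beta>: "has_next \<beta>" and zz: "z \<beta> = z' \<beta>"
      have n: "\<beta> \<sqsubseteq> \<sigma> \<beta>" "\<sigma> \<beta> \<in> Field r"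
        using next_props[OF \<beta>] by auto
      show "z (\<sigma> \<beta>) = z' (\<sigma> \<beta>)"
      proof (rule kernel_inj[OF \<beta>])
        show "z (\<sigma> \<beta>) \<in> topspace (K (\<sigma> \<beta>))" "z' (\<sigma> \<beta>) \<in> topspace (K (\<sigma> \<beta>))"
          using thread_in t n(2) by auto
        show "p \<beta> (\<sigma> \<beta>) (z (\<sigma> \<beta>)) = p \<beta> (\<sigma> \<beta>) (z' (\<sigma> \<beta>))"
          using thread_p[OF t(1) n(2,1)] thread_p[OF t(2) n(2,1)] zz by simp
        show "kernel \<beta> n (z (\<sigma> \<beta>)) = kernel \<beta> n (z' (\<sigma> \<beta>))" for n
          using fun_cong[OF eq, of "Inr (\<beta>, n)"] by (simp only: embed_Inr[OF \<beta>])
      qed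
    qed
  qed
qed

text \<open>A nonempty open set contains all threads through some nonempty open subset of a single
  \<open>K \<alpha>\<close>, and \<open>c0_thread_dense\<close> provides one of them.\<close>

lemma inverse_limit_dense:
  "inverse_limit r K p closure_of {z \<in> topspace (inverse_limit r K p). embed z \<in> c0 index_set}
     = topspace (inverse_limit r K p)"
  unfolding dense_intersects_open
proof (intro allI impI, elim conjE)
  fix U assume U: "openin (inverse_limit r K p) U" "U \<noteq> {}"
  then obtain x where x: "x \<in> U"
    by blast
  have "openin (inverse_limit (Restr r (Field r)) K p) U"
    using U(1) by (simp add: Restr_Field)
  then obtain \<alpha> V where \<alpha>: "\<alpha> \<in> Field r" "openin (K \<alpha>) V" "x \<alpha> \<in> V"
      "\<forall>z. z \<in> extensional (Field r) \<and> thread (Field r) z \<and> z \<alpha> \<in> V \<longrightarrow> z \<in> U"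
    using inverse_limit_basis[OF Field_ofilter Field_nonempty _ x] by blast
  then obtain z where z: "c0_thread z" "z \<alpha> \<in> V"
    using c0_thread_dense[of \<alpha> V] by blast
  \<comment> \<open>Points of the limit must be \<open>undefined\<close> off \<open>Field r\<close>.
    The restriction leaves the image under \<open>embed\<close> unchanged, because only values at
    indices in the field are read.\<close>
  define z' where "z' = restrict z (Field r)"
  have z'_eq: "z' \<beta> = z \<beta>" if "\<beta> \<in> Field r" for \<beta>
    using that by (simp add: z'_def)
  have t: "thread (Field r) z'"
    using z(1) le_Field by (auto simp: c0_thread_def thread_def z'_eq)
  have "z' \<in> U"
    using \<alpha> t z(2) by (simp add: z'_def)
  moreover have "embed z' = embed z"
    unfolding embed_def
  proof (rule restrict_ext)
    fix i assume "i \<in> index_set"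
    then consider a where "i = Inl a" | \<beta> n where "i = Inr (\<beta>, n)" "has_next \<beta>"
      unfolding index_set_def by blast
    then show "(case i of Inl a \<Rightarrow> h (z' (ord_zero r)) a | Inr (\<beta>, n) \<Rightarrow> kernel \<beta> n (z' (\<sigma> \<beta>)))
        = (case i of Inl a \<Rightarrow> h (z (ord_zero r)) a | Inr (\<beta>, n) \<Rightarrow> kernel \<beta> n (z (\<sigma> \<beta>)))"
      using next_props z'_eq zero_in by cases auto
  qed
  ultimately show "{z \<in> topspace (inverse_limit r K p). embed z \<in> c0 index_set} \<inter> U \<noteq> {}"
    using embed_c0[OF z(1)] openin_subset[OF U(1)] by auto
qed

text \<open>A continuous injection of a compact space into a Hausdorff space is an embedding. The
  index set has a sum type here; \<open>semi_EberleinI\<close> passes to the type used in the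
  definition.\<close>

lemma semi_Eberlein_inverse_limit: "semi_Eberlein (inverse_limit r K p)"
proof -
  let ?L = "inverse_limit r K p"
  have L: "compact_space ?L" "Hausdorff_space ?L"
    using inverse_limit_compact_Hausdorff[of r K p] seq K_compact_Hausdorff
    by (auto simp: continuous_inverse_sequence_def)
  have "Hausdorff_space (powertop_real index_set)"
    by (simp add: Hausdorff_space_product_topology)
  then have "embedding_map ?L (powertop_real index_set) embed"
    using L(1) embed_continuous embed_inj
    by (intro injective_closed_imp_embedding_map continuous_imp_closed_map)
  then have "semi_Eberlein_embedding ?L index_set embed"
    using inverse_limit_dense by (simp add: semi_Eberlein_embedding_dense)
  then show ?thesis
    by (rule semi_EberleinI[OF L])
qed

end

theorem theorem4p2:
  fixes r :: "'i rel"
    and K :: "'i \<Rightarrow> 'a topology"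
    and p :: "'i \<Rightarrow> 'i \<Rightarrow> 'a \<Rightarrow> 'a"
  assumes "continuous_inverse_sequence r K p"
    and "\<And>\<alpha>. \<alpha> \<in> Field r \<Longrightarrow> compact_space (K \<alpha>) \<and> Hausdorff_space (K \<alpha>)"
    and "semi_Eberlein (K (ord_zero r))"
    and "\<And>\<alpha>. \<alpha> \<in> Field r \<Longrightarrow> aboveS r \<alpha> \<noteq> {} \<Longrightarrow>
           retraction_map (K (ord_succ r \<alpha>)) (K \<alpha>) (p \<alpha> (ord_succ r \<alpha>)) \<and>
           semi_open_map (K (ord_succ r \<alpha>)) (K \<alpha>) (p \<alpha> (ord_succ r \<alpha>)) \<and>
           has_metrizable_kernel (K (ord_succ r \<alpha>)) (p \<alpha> (ord_succ r \<alpha>))"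
  shows "semi_Eberlein (inverse_limit r K p)"
proof -
  let ?\<sigma> = "ord_succ r" and ?N = "\<lambda>\<alpha>. \<alpha> \<in> Field r \<and> aboveS r \<alpha> \<noteq> {}"
  let ?sec = "\<lambda>\<alpha> s. retraction_maps (K (?\<sigma> \<alpha>)) (K \<alpha>) (p \<alpha> (?\<sigma> \<alpha>)) s"
  let ?ker = "\<lambda>\<alpha> (g :: 'a \<Rightarrow> nat \<Rightarrow> real).
    continuous_map (K (?\<sigma> \<alpha>)) (product_topology (\<lambda>_. top_of_set {0..1}) UNIV) g
    \<and> inj_on (\<lambda>x. (p \<alpha> (?\<sigma> \<alpha>) x, g x)) (topspace (K (?\<sigma> \<alpha>)))"
  obtain S :: "('a \<Rightarrow> real) set" and h where h: "semi_Eberlein_embedding (K (ord_zero r)) S h"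
    using assms(3) by (auto simp: semi_Eberlein_def)
  \<comment> \<open>Sections and kernel maps are chosen for all indices simultaneously; at a largest
    index the chosen values are arbitrary.\<close>
  define s where "s \<alpha> = (SOME s. ?sec \<alpha> s)" for \<alpha>
  define g :: "'i \<Rightarrow> 'a \<Rightarrow> nat \<Rightarrow> real" where "g \<alpha> = (SOME g. ?ker \<alpha> g)" for \<alpha>
  have s: "?sec \<alpha> (s \<alpha>)" if "?N \<alpha>" for \<alpha>
  proof -
    have "\<exists>s. ?sec \<alpha> s"
      using assms(4)[of \<alpha>] that by (simp add: retraction_map_def)
    then show ?thesis
      unfolding s_def by (rule someI_ex)
  qed
  have g: "?ker \<alpha> (g \<alpha>)" if "?N \<alpha>" for \<alpha>
  proof -
    have "\<exists>g. ?ker \<alpha> g"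
      using assms(4)[of \<alpha>] that by (simp add: has_metrizable_kernel_def)
    then show ?thesis
      unfolding g_def by (rule someI_ex)
  qed
  have "Well_order r"
    using assms(1) by (simp add: continuous_inverse_sequence_def inverse_sequence_def)
  then interpret wo_rel r
    by (simp add: wo_rel_def)
  interpret semi_Eberlein_retractive_sequence r K p s S h g
  proof
    fix \<alpha>
    show "retraction_maps (K (?\<sigma> \<alpha>)) (K \<alpha>) (p \<alpha> (?\<sigma> \<alpha>)) (s \<alpha>)"
      if "\<alpha> \<in> Field r" "aboveS \<alpha> \<noteq> {}"
      using s that by simp
    assume \<alpha>: "\<alpha> \<in> Field r \<and> aboveS \<alpha> \<noteq> {}"
    show "semi_open_map (K (?\<sigma> \<alpha>)) (K \<alpha>) (p \<alpha> (?\<sigma> \<alpha>))"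
      using assms(4)[of \<alpha>] \<alpha> by simp
    show "continuous_map (K (?\<sigma> \<alpha>)) (product_topology (\<lambda>_. top_of_set {0..1}) UNIV) (g \<alpha>)"
      "inj_on (\<lambda>x. (p \<alpha> (?\<sigma> \<alpha>) x, g \<alpha> x)) (topspace (K (?\<sigma> \<alpha>)))"
      using g[OF \<alpha>] by simp_all
  qed (use assms(1,2) h in simp_all)
  show ?thesis
    by (rule semi_Eberlein_inverse_limit)
qed

end
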